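(* There is an absolute constant $C>0$ such that the following holds. Let $\varepsilon\in(0,1)$ be a real number. Assume that $H^\times(a_0;a_1,a_2,\ldots,a_d)\subseteq\{x^k-n: x\in\mathbb{N}\}$, where $k,n,a_0$ are positive integers with $k\geq 2$ and $a_0\leq n^{\frac{k-1}{k}-\varepsilon}$, and $a_1,\ldots,a_d$ are distinct positive integers. Then $$d\leq \frac{C}{\varepsilon}.$$
   Context: $\mathbb{N}$ is the set of positive integers. For a positive integer $a_0$ and distinct positive integers $a_1,\ldots,a_d$, the multiplicative Hilbert cube is $$H^\times(a_0;a_1,\ldots,a_d)=\Big\{a_0\prod_{i\in I}a_i: I\subseteq\{1,2,\ldots,d\}\Big\},$$ where the empty product equals $1$. *)

theory Defs
  imports Complex_Main
begin

(* The generators a_1, ..., a_d are the values of a on {1..d}; all other values of a are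
   irrelevant. Positivity of a0 and of the generators, and distinctness of the generators,
   are not part of the definition and must be assumed where it is used. *)
definition mult_hilbert_cube :: "nat \<Rightarrow> (nat \<Rightarrow> nat) \<Rightarrow> nat \<Rightarrow> nat set" where
  "mult_hilbert_cube a0 a d = {a0 * (\<Prod>i\<in>I. a i) | I. I \<subseteq> {1..d}}"

(* A set of integers, since truncated subtraction on nat would send every x ^ k < n to 0. *)
definition shifted_powers :: "nat \<Rightarrow> nat \<Rightarrow> int set" where
  "shifted_powers k n = {int x ^ k - int n | x :: nat. x > 0}"

end

theory Submission
  imports Defs
begin

text \<open>
  The proof compares four points of the cube. If \<open>m + n\<close>, \<open>m * A + n\<close>, \<open>m * B + n\<close> and
  \<open>m * A * B + n\<close> are the \<open>k\<close>-th powers of \<open>x\<close>, \<open>y\<close>, \<open>z\<close> and \<open>w\<close>, then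
  \<open>(x * w) ^ k - (y * z) ^ k = n * m * (A - 1) * (B - 1)\<close>,
  which is linear in \<open>m\<close>, whereas both powers on the left have size about \<open>m\<^sup>2 * A * B\<close>.
  For \<open>k \<ge> 3\<close> distinct \<open>k\<close>-th powers of that size are too far apart once \<open>m\<close> is large. For \<open>k = 2\<close>
  sizes alone do not decide, but then the difference \<open>x * w - y * z\<close> is an integer
  whose square is only just below \<open>n\<^sup>2 * (A - 1)\<^sup>2 * (B - 1)\<^sup>2 / (4 * A * B)\<close>, closer than integrality
  permits. Either way \<open>m < 2 * n ^ 3 * (A * B)\<^sup>2\<close> (lemma \<open>power_rectangle_bound\<close>).

  On the other hand a cube of large dimension provides such rectangles with a huge corner \<open>m\<close>.
  Since \<open>a\<^sub>0 + n\<close> and \<open>a\<^sub>0 * t + n\<close> are both \<open>k\<close>-th powers, their distance is at least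
  \<open>n powr ((k - 1) / k)\<close>, so the hypothesis on \<open>a\<^sub>0\<close> forces every generator \<open>t > 1\<close> to
  be at least \<open>n powr \<epsilon>\<close> (lemma \<open>generator_large\<close>). Take for \<open>A < B\<close> the two smallest generators
  above \<open>1\<close> and let \<open>m\<close> be \<open>a\<^sub>0\<close> times the product of all larger ones: four of these larger
  generators pay for \<open>(A * B)\<^sup>2\<close>, and \<open>4 / \<epsilon>\<close> further ones pay for \<open>2 * n ^ 3 \<le> n ^ 4\<close>.
\<close>

section \<open>Rectangles of shifted powers\<close>

lemma power_less_imp_gap:
  fixes X Y k :: nat
  assumes "Y ^ k < X ^ k" "k > 0"
  shows "Y ^ k + Y ^ (k - 1) \<le> X ^ k"
proof -
  obtain j where j: "k = Suc j" using \<open>k > 0\<close> gr0_implies_Suc by blast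
  have "Y < X" using assms(1) by (rule power_less_imp_less_base) simp
  then have "Suc Y * Y ^ j \<le> X * X ^ j" by (intro mult_mono power_mono) auto
  then show ?thesis using j by simp
qed

lemma rectangle_product_identity:
  fixes m A B n :: nat
  assumes "A \<ge> 1" "B \<ge> 1"
  shows "(m + n) * (m * A * B + n) = (m * A + n) * (m * B + n) + n * m * (A - 1) * (B - 1)"
proof -
  obtain a b where "A = Suc a" "B = Suc b"
    using assms by (metis Suc_le_D One_nat_def)
  then show ?thesis by (simp add: algebra_simps)
qed

text \<open>
  Distinct \<open>k\<close>-th powers exceeding \<open>m\<^sup>2 * A * B\<close> differ by at least its power with exponent
  \<open>(k - 1) / k\<close>, in which \<open>m\<close> has exponent \<open>2 - 2 / k > 1\<close>; here the difference is only linear in \<open>m\<close>.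
\<close>

lemma higher_power_rectangle_bound:
  fixes m A B n k X Y :: nat
  assumes k: "k \<ge> 3" and A: "A \<ge> 2" and B: "B \<ge> 2" and n: "n > 0" and m: "m > 0"
    and Y: "Y ^ k = (m * A + n) * (m * B + n)"
    and X: "X ^ k = Y ^ k + n * m * (A - 1) * (B - 1)"
  shows "m < n ^ 3 * (A * B)"
proof (rule ccontr)
  assume "\<not> m < n ^ 3 * (A * B)"
  then have large: "n ^ 3 * (A * B) \<le> m" by simp
  define P where "P = A * B"
  have P: "P \<ge> 1" using A B by (simp add: P_def)
  obtain j where j: "k = j + 3" using k by (metis add.commute le_Suc_ex)
  have "Y ^ k + Y ^ (k - 1) \<le> X ^ k"
    using X A B n m k by (intro power_less_imp_gap) auto
  then have "Y ^ (k - 1) \<le> n * m * ((A - 1) * (B - 1))" using X by (simp add: mult.assoc)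
  also have "\<dots> \<le> n * m * P" unfolding P_def by (intro mult_mono) auto
  finally have "(Y ^ (k - 1)) ^ k \<le> (n * m * P) ^ k" by (rule power_mono) simp
  moreover have "(m * m * P) ^ (k - 1) < (Y ^ k) ^ (k - 1)"
    using k n by (intro power_strict_mono) (auto simp: Y P_def algebra_simps)
  moreover have "(Y ^ k) ^ (k - 1) = (Y ^ (k - 1)) ^ k"
    by (metis power_mult mult.commute)
  ultimately have "(m * m * P) ^ (k - 1) < (n * m * P) ^ k" by linarith
  then have "(m ^ (j + 3) * P ^ (j + 2)) * m ^ (j + 1) < (m ^ (j + 3) * P ^ (j + 2)) * (n ^ (j + 3) * P)"
    unfolding j by (simp add: power_mult_distrib power_add algebra_simps power2_eq_square power3_eq_cube)
  then have "m ^ (j + 1) < n ^ (j + 3) * P" by simp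
  also have "\<dots> \<le> n ^ (3 * (j + 1)) * P ^ (j + 1)"
    using n P self_le_power[of P "j + 1"] by (intro mult_mono power_increasing) auto
  also have "\<dots> = (n ^ 3 * P) ^ (j + 1)" by (simp only: power_mult_distrib power_mult)
  also have "\<dots> \<le> m ^ (j + 1)" using large unfolding P_def by (intro power_mono) auto
  finally show False by simp
qed

text \<open>
  Put \<open>D = X - Y\<close>, \<open>S = X + Y\<close> and \<open>Q = n * (A - 1) * (B - 1)\<close>, so that \<open>D * S = m * Q\<close>.
  As \<open>S\<close> is slightly above \<open>2 * m * sqrt (A * B)\<close>, the integer \<open>4 * A * B * D\<^sup>2\<close> is
  slightly below \<open>Q\<^sup>2\<close>, hence at most \<open>Q\<^sup>2 - 1\<close>; this contradicts the upper bound on \<open>S\<close> when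
  \<open>m\<close> is large.
\<close>

lemma square_rectangle_bound:
  fixes m A B n X Y :: nat
  assumes A: "A \<ge> 2" and B: "B \<ge> 2" and n: "n > 0" and m: "m > 0"
    and Y: "Y ^ 2 = (m * A + n) * (m * B + n)"
    and X: "X ^ 2 = Y ^ 2 + n * m * (A - 1) * (B - 1)"
  shows "m < 2 * n ^ 3 * (A * B)\<^sup>2"
proof (rule ccontr)
  assume "\<not> m < 2 * n ^ 3 * (A * B)\<^sup>2"
  then have large: "2 * n ^ 3 * (A * B)\<^sup>2 \<le> m" by simp
  define P where "P = A * B"
  define Q where "Q = n * ((A - 1) * (B - 1))"
  have P4: "4 \<le> P" using mult_mono[OF A B] by (simp add: P_def)
  have Q0: "Q > 0" using A B n by (simp add: Q_def)
  have QP: "Q \<le> n * P" unfolding Q_def P_def by (intro mult_mono) auto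
  have XQ: "X ^ 2 = Y ^ 2 + m * Q" using X by (simp add: Q_def mult_ac)
  then have "Y ^ 2 < X ^ 2" using m Q0 by simp
  then have "Y < X" by (rule power_less_imp_less_base) simp
  then obtain D where D: "X = Y + D" using less_imp_add_positive by blast
  define S where "S = X + Y"
  have DS: "D * S = m * Q"
    using XQ by (simp add: D S_def power2_eq_square algebra_simps)
  have Ylow: "P * m ^ 2 < Y ^ 2"
    unfolding Y using n by (simp add: P_def power2_eq_square algebra_simps)
  have "(2 * Y) ^ 2 \<le> S ^ 2" using \<open>Y < X\<close> unfolding S_def by (intro power_mono) auto
  with Ylow have Slow: "4 * P * m ^ 2 < S ^ 2" by (simp add: power_mult_distrib)
  have DSQ: "(4 * P * D ^ 2) * S ^ 2 = (4 * P * m ^ 2) * Q ^ 2"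
    using arg_cong[OF DS, of "\<lambda>t. 4 * P * t ^ 2"] by (simp add: power_mult_distrib)
  also have "(4 * P * m ^ 2) * Q ^ 2 < Q ^ 2 * S ^ 2" using Slow Q0 by (simp add: mult.commute)
  finally have "4 * P * D ^ 2 < Q ^ 2" by simp
  then have "(4 * P * D ^ 2 + 1) * S ^ 2 \<le> Q ^ 2 * S ^ 2" by (intro mult_right_mono) auto
  then have gap: "(4 * P * m ^ 2) * Q ^ 2 + S ^ 2 \<le> Q ^ 2 * S ^ 2"
    by (simp only: add_mult_distrib DSQ mult_1)
  define E where "E = 2 * n * m * ((1 + A) * (1 + B)) + 4 * n ^ 2"
  have "S ^ 2 + D ^ 2 = 2 * (X ^ 2 + Y ^ 2)"
    by (simp add: S_def D power2_eq_square algebra_simps)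
  moreover have "X ^ 2 = (m + n) * (m * A * B + n)"
    using X Y rectangle_product_identity[of A B m n] A B by simp
  ultimately have "S ^ 2 \<le> 2 * ((m + n) * (m * A * B + n) + (m * A + n) * (m * B + n))"
    using Y by (metis le_add1)
  also have "\<dots> = 4 * P * m ^ 2 + E"
    by (simp add: P_def E_def power2_eq_square algebra_simps)
  finally have Sup: "S ^ 2 \<le> 4 * P * m ^ 2 + E" .
  have "Q ^ 2 * S ^ 2 \<le> Q ^ 2 * (4 * P * m ^ 2 + E)" using Sup by (rule mult_left_mono) simp
  with gap Slow have lower: "4 * P * m ^ 2 < Q ^ 2 * E" by (simp add: algebra_simps)
  have "n \<le> n * (2 * n ^ 2 * P ^ 2)" using n P4 by simp
  also have "\<dots> = 2 * n ^ 3 * P ^ 2" by (simp add: power3_eq_cube power2_eq_square)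
  finally have "n \<le> m" using large by (simp add: P_def)
  \<comment> \<open>Since \<open>1 + A \<le> 3 * A / 2\<close>, we get \<open>(1 + A) * (1 + B) \<le> 9 * A * B / 4 < 3 * A * B\<close>.\<close>
  have "(2 * (1 + A)) * (2 * (1 + B)) \<le> (3 * A) * (3 * B)" using A B by (intro mult_le_mono[of "2 * (1 + A)"]) simp_all
  then have AB: "4 * ((1 + A) * (1 + B)) \<le> 9 * P" by (simp add: P_def algebra_simps)
  have "E \<le> 2 * n * m * ((1 + A) * (1 + B)) + 4 * (n * m)"
    unfolding E_def using \<open>n \<le> m\<close> by (simp add: power2_eq_square)
  also have "\<dots> = (n * m) * (2 * ((1 + A) * (1 + B)) + 4)" by (simp add: algebra_simps)
  also have "\<dots> \<le> (n * m) * (8 * P)" using AB P4 by (intro mult_left_mono) auto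
  finally have "Q ^ 2 * E \<le> (n * P) ^ 2 * ((n * m) * (8 * P))"
    using QP by (intro mult_mono power_mono) auto
  also have "\<dots> = 4 * P * m * (2 * n ^ 3 * P ^ 2)"
    by (simp add: power3_eq_cube power2_eq_square algebra_simps)
  also have "\<dots> \<le> 4 * P * m * m" using large unfolding P_def by (intro mult_left_mono) auto
  finally show False using lower by (simp add: power2_eq_square)
qed

lemma power_rectangle_bound:
  fixes m A B n k x y z w :: nat
  assumes k: "k \<ge> 2" and A: "A \<ge> 2" and B: "B \<ge> 2" and n: "n > 0" and m: "m > 0"
    and x: "m + n = x ^ k" and y: "m * A + n = y ^ k"
    and z: "m * B + n = z ^ k" and w: "m * A * B + n = w ^ k"
  shows "m < 2 * n ^ 3 * (A * B)\<^sup>2"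
proof -
  have Y: "(y * z) ^ k = (m * A + n) * (m * B + n)"
    by (simp add: y z power_mult_distrib)
  have "(x * w) ^ k = (m + n) * (m * A * B + n)"
    by (simp add: x w power_mult_distrib)
  then have X: "(x * w) ^ k = (y * z) ^ k + n * m * (A - 1) * (B - 1)"
    using rectangle_product_identity[of A B m n] A B Y by simp
  show ?thesis
  proof (cases "k = 2")
    case True
    then show ?thesis using square_rectangle_bound[OF A B n m] X Y by simp
  next
    case False
    then have "m < n ^ 3 * (A * B)"
      using higher_power_rectangle_bound[OF _ A B n m Y X] k by simp
    also have "\<dots> \<le> n ^ 3 * (2 * (A * B)\<^sup>2)"
      by (intro mult_left_mono) (auto simp: power2_eq_square)
    finally show ?thesis by (simp add: mult_ac)
  qed
qed

section \<open>Growth of the generators\<close>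

lemma generator_large:
  fixes k n a0 t x y :: nat and \<epsilon> :: real
  assumes k: "k \<ge> 2" and n: "n > 0" and a0: "a0 > 0" and t: "t \<ge> 2"
    and x: "a0 + n = x ^ k" and y: "a0 * t + n = y ^ k"
    and small: "real a0 \<le> real n powr ((real k - 1) / real k - \<epsilon>)"
  shows "real n powr \<epsilon> \<le> real t"
proof -
  have "x ^ k + x ^ (k - 1) \<le> y ^ k"
    using x[symmetric] y[symmetric] t a0 k by (intro power_less_imp_gap) auto
  then have gap: "x ^ (k - 1) \<le> a0 * t" using x y by linarith
  have x0: "x > 0" using x n k by (intro gr0I) (auto simp: zero_power)
  have "real n \<le> real (x ^ k)" using x by (metis le_add2 of_nat_le_iff)
  then have "real n powr ((real k - 1) / real k) \<le> (real x ^ k) powr ((real k - 1) / real k)"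
    using k by (intro powr_mono2) auto
  also have "\<dots> = real x powr real (k - 1)"
    using x0 k by (simp add: powr_powr of_nat_diff flip: powr_realpow)
  also have "\<dots> = real (x ^ (k - 1))" using x0 by (simp add: powr_realpow)
  also have "\<dots> \<le> real a0 * real t" using gap by (metis of_nat_le_iff of_nat_mult)
  finally have "real n powr ((real k - 1) / real k) \<le> real a0 * real t" .
  moreover have "real a0 * real n powr \<epsilon> \<le> real n powr ((real k - 1) / real k)"
    using mult_right_mono[OF small, of "real n powr \<epsilon>"] n by (simp flip: powr_add)
  ultimately have "real a0 * real n powr \<epsilon> \<le> real a0 * real t" by linarith
  then show ?thesis using a0 by simp
qed

section \<open>The dimension bound\<close>

text \<open>
  For injective generators the products over index sets are the products over sets of values,
  so the two smallest generators can be removed without reindexing.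
\<close>

lemma shifted_power_of_subset:
  assumes inj: "inj_on a {1..d}"
    and sub: "int ` mult_hilbert_cube a0 a d \<subseteq> shifted_powers k n"
    and V: "V \<subseteq> a ` {1..d}"
  obtains x :: nat where "a0 * \<Prod>V + n = x ^ k"
proof -
  from V obtain I where I: "I \<subseteq> {1..d}" "V = a ` I" by (auto simp: subset_image_iff)
  have "\<Prod>V = (\<Prod>i\<in>I. a i)"
    using prod.reindex[of a I id] I inj inj_on_subset by fastforce
  then have "a0 * \<Prod>V \<in> mult_hilbert_cube a0 a d"
    using I unfolding mult_hilbert_cube_def by auto
  then have "int (a0 * \<Prod>V) \<in> shifted_powers k n" using sub by blast
  then obtain x :: nat where "int (a0 * \<Prod>V) = int x ^ k - int n"
    unfolding shifted_powers_def by auto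
  then have "int (a0 * \<Prod>V + n) = int (x ^ k)" by simp
  then have "a0 * \<Prod>V + n = x ^ k" by (simp only: of_nat_eq_iff)
  then show thesis by (rule that)
qed

text \<open>
  All elements of \<open>R\<close> are at least \<open>M = max B (n powr \<epsilon>)\<close>, so \<open>\<Prod>R \<ge> M ^ card R\<close>; four factors
  \<open>M\<close> are estimated by \<open>B\<close> and the others by \<open>n powr \<epsilon>\<close>.
\<close>

lemma prod_large_generators:
  fixes R :: "nat set" and A B n :: nat and \<epsilon> :: real
  assumes n: "n \<ge> 2" and \<epsilon>: "\<epsilon> > 0" and AB: "1 \<le> A" "A \<le> B"
    and R: "\<And>t. t \<in> R \<Longrightarrow> B \<le> t" "\<And>t. t \<in> R \<Longrightarrow> real n powr \<epsilon> \<le> real t"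
    and card: "real (card R) \<ge> 4 + 4 / \<epsilon>"
  shows "2 * n ^ 3 * (A * B)\<^sup>2 \<le> \<Prod>R"
proof -
  define M where "M = max (real B) (real n powr \<epsilon>)"
  define s where "s = card R - 4"
  have "4 \<le> real (card R)" using card \<epsilon> by (smt (verit) divide_pos_pos)
  then have cardR: "card R = 4 + s" unfolding s_def by simp
  have "real s * \<epsilon> \<ge> 4" using card \<epsilon> unfolding cardR by (simp add: field_simps)
  have "real n ^ 4 = real n powr 4" using n by (simp flip: powr_numeral)
  also have "\<dots> \<le> real n powr (\<epsilon> * real s)"
    using \<open>real s * \<epsilon> \<ge> 4\<close> n by (intro powr_mono) (auto simp: mult.commute)
  also have "\<dots> = (real n powr \<epsilon>) ^ s" using n by (simp add: powr_powr flip: powr_realpow)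
  also have "\<dots> \<le> M ^ s" unfolding M_def by (intro power_mono) auto
  finally have nM: "real n ^ 4 \<le> M ^ s" .
  have "2 * n ^ 3 * (A * B)\<^sup>2 \<le> n * n ^ 3 * (B * B)\<^sup>2"
    using n AB by (intro mult_mono power_mono) auto
  also have "\<dots> = B ^ 4 * n ^ 4" by (simp add: power2_eq_square power4_eq_xxxx power3_eq_cube)
  finally have "real (2 * n ^ 3 * (A * B)\<^sup>2) \<le> real B ^ 4 * real n ^ 4"
    by (metis of_nat_le_iff of_nat_mult of_nat_power)
  also have "\<dots> \<le> M ^ 4 * M ^ s"
    using nM by (intro mult_mono power_mono) (auto simp: M_def)
  also have "\<dots> = (\<Prod>t\<in>R. M)" by (simp add: cardR power_add)
  also have "\<dots> \<le> (\<Prod>t\<in>R. real t)"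
    using R by (intro prod_mono) (auto simp: M_def)
  also have "\<dots> = real (\<Prod>R)" by simp
  finally show ?thesis by (simp only: of_nat_le_iff)
qed

lemma cube_in_shifted_powers_dimension:
  fixes \<epsilon> :: real and k n a0 d :: nat and a :: "nat \<Rightarrow> nat"
  assumes \<epsilon>: "0 < \<epsilon>" "\<epsilon> < 1" and k: "k \<ge> 2" and n: "n > 0" and a0: "a0 > 0"
    and small: "real a0 \<le> real n powr ((real k - 1) / real k - \<epsilon>)"
    and pos: "\<forall>i\<in>{1..d}. a i > 0" and inj: "inj_on a {1..d}"
    and sub: "int ` mult_hilbert_cube a0 a d \<subseteq> shifted_powers k n"
  shows "real d \<le> 11 / \<epsilon>"
proof (rule ccontr)
  assume "\<not> real d \<le> 11 / \<epsilon>"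
  \<comment> \<open>Three generators may be lost, namely \<open>1\<close>, \<open>A\<close> and \<open>B\<close>; the others must number \<open>4 + 4 / \<epsilon>\<close>.\<close>
  moreover have "7 \<le> 7 / \<epsilon>" using \<epsilon> by (simp add: field_simps)
  ultimately have d: "real d > 7 + 4 / \<epsilon>" by (simp add: add_divide_distrib[symmetric])
  have "4 / \<epsilon> > 0" using \<epsilon> by simp
  then have d7: "d \<ge> 7" using d by linarith
  define T where "T = a ` {1..d} - {1}"
  have cube: "\<exists>x. a0 * \<Prod>V + n = x ^ k" if "V \<subseteq> T" for V
    using shifted_power_of_subset[OF inj sub, of V] that unfolding T_def by blast
  have fin: "finite T" by (simp add: T_def)
  have "card (a ` {1..d}) = d" using inj by (simp add: card_image)
  then have cardT: "d - 1 \<le> card T"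
    unfolding T_def using diff_card_le_card_Diff[of "{1}" "a ` {1..d}"] by simp
  have ge2: "t \<ge> 2" if "t \<in> T" for t
    using that pos unfolding T_def by (metis DiffE One_nat_def Suc_1 Suc_leI image_iff
        insertI1 le_neq_implies_less)
  obtain x where x: "a0 + n = x ^ k" using cube[of "{}"] by auto
  \<comment> \<open>For \<open>n = 1\<close> the growth condition is void, but then \<open>a\<^sub>0 + n = 2\<close> is not a perfect power.\<close>
  have n2: "n \<ge> 2"
  proof (rule ccontr)
    assume "\<not> n \<ge> 2"
    then have "n = 1" using n by simp
    then have "x ^ k = 2" using x a0 small by simp
    then have "x \<ge> 2" using k by (cases "x = 0 \<or> x = 1") (auto simp: zero_power)
    then have "2 ^ k \<le> x ^ k" by (intro power_mono) auto
    moreover have "(2::nat) ^ 2 \<le> 2 ^ k" using k by (intro power_increasing) auto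
    ultimately have "2 ^ 2 \<le> x ^ k" by linarith
    with \<open>x ^ k = 2\<close> show False by simp
  qed
  have grow: "real n powr \<epsilon> \<le> real t" if t: "t \<in> T" for t
  proof -
    obtain y where "a0 * t + n = y ^ k" using cube[of "{t}"] t by auto
    then show ?thesis using generator_large[OF k n a0 ge2[OF t] x _ small] by simp
  qed
  define A where "A = Min T"
  have "T \<noteq> {}" using cardT d7 by auto
  then have AT: "A \<in> T" and Amin: "\<And>t. t \<in> T \<Longrightarrow> A \<le> t"
    unfolding A_def using fin by auto
  define B where "B = Min (T - {A})"
  have cardTA: "card (T - {A}) = card T - 1" using AT by simp
  then have "card (T - {A}) > 0" using cardT d7 by linarith
  then have "T - {A} \<noteq> {}" using card_gt_0_iff by blast
  then have BT: "B \<in> T - {A}" and Bmin: "\<And>t. t \<in> T - {A} \<Longrightarrow> B \<le> t"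
    unfolding B_def using fin Min_in[of "T - {A}"] by auto
  define R where "R = T - {A} - {B}"
  have finR: "finite R" using fin by (simp add: R_def)
  have "card R = card T - 2" using BT cardTA by (simp add: R_def)
  then have "real d - 3 \<le> real (card R)" using cardT by linarith
  then have cardR: "4 + 4 / \<epsilon> \<le> real (card R)" using d by linarith
  have "2 * n ^ 3 * (A * B)\<^sup>2 \<le> \<Prod>R"
  proof (rule prod_large_generators[OF n2 \<epsilon>(1) _ _ _ _ cardR])
    show "1 \<le> A" using ge2[OF AT] by simp
    show "A \<le> B" using Amin BT by simp
    show "B \<le> t" if "t \<in> R" for t using that Bmin by (simp add: R_def)
    show "real n powr \<epsilon> \<le> real t" if "t \<in> R" for t using that grow by (simp add: R_def)
  qed
  also have "\<dots> \<le> a0 * \<Prod>R" using a0 by simp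
  finally have large: "2 * n ^ 3 * (A * B)\<^sup>2 \<le> a0 * \<Prod>R" .
  have RT: "R \<subseteq> T" "insert A R \<subseteq> T" "insert B R \<subseteq> T" "insert A (insert B R) \<subseteq> T"
    using AT BT by (auto simp: R_def)
  have notin: "A \<notin> R" "B \<notin> R" "A \<noteq> B" using BT by (auto simp: R_def)
  obtain p where p: "a0 * \<Prod>R + n = p ^ k" using cube[OF RT(1)] by blast
  obtain q where q: "a0 * \<Prod>R * A + n = q ^ k"
    using cube[OF RT(2)] finR notin by (auto simp: mult_ac)
  obtain r where r: "a0 * \<Prod>R * B + n = r ^ k"
    using cube[OF RT(3)] finR notin by (auto simp: mult_ac)
  obtain s where s: "a0 * \<Prod>R * A * B + n = s ^ k"
    using cube[OF RT(4)] finR notin by (auto simp: mult_ac)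
  have "0 < \<Prod>R" using RT(1) ge2 by (intro prod_pos) force
  then have "a0 * \<Prod>R < 2 * n ^ 3 * (A * B)\<^sup>2"
    using power_rectangle_bound[OF k ge2[OF AT] ge2 n _ p q r s] BT a0 by simp
  with large show False by simp
qed

theorem theorem1p9:
  shows "\<exists>C::real. C > 0 \<and>
    (\<forall>(\<epsilon>::real) (k::nat) (n::nat) (a0::nat) (d::nat) (a::nat \<Rightarrow> nat).
       0 < \<epsilon> \<longrightarrow> \<epsilon> < 1 \<longrightarrow>
       k \<ge> 2 \<longrightarrow> n > 0 \<longrightarrow> a0 > 0 \<longrightarrow>
       real a0 \<le> real n powr ((real k - 1) / real k - \<epsilon>) \<longrightarrow>
       (\<forall>i\<in>{1..d}. a i > 0) \<longrightarrow> inj_on a {1..d} \<longrightarrow>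
       int ` mult_hilbert_cube a0 a d \<subseteq> shifted_powers k n \<longrightarrow>
       real d \<le> C / \<epsilon>)"
  using cube_in_shifted_powers_dimension by (intro exI[of _ 11]) auto

end
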